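(* Let $r,s$ be non-negative integers and $n,\lambda$ positive integers with $\max\{r,s\}\le n$. A simple $r\times s$ $\lambda$-Latin rectangle $M$ on the symbol set $[n]$ can be extended to a simple $n\times n$ $\lambda$-Latin square if and only if $\lambda\le n$ and all of the following hold: \begin{align*} &\lambda(r+s-n)\le|M_\ell|\le\lambda(r+s-n)+(n-r)(n-s) &&\text{for all }\ell\in[n],\\ &|M^i_\ell|\ge\lambda+s-n &&\text{for all }i\in[r],\ \ell\in[n],\\ &|{}^jM_\ell|\ge\lambda+r-n &&\text{for all }j\in[s],\ \ell\in[n]. \end{align*}
   Context: $[m]=\{1,\dots,m\}$ (so $[0]=\varnothing$). An $r\times s$ $\lambda$-Latin rectangle $M$ on $[n]$ is an $r\times s$ array in which each cell contains a multiset of exactly $\lambda$ elements of $[n]$ such that each symbol occurs at most $\lambda$ times (with multiplicity) in each row and in each column. If $r=s=n$ it is an $n\times n$ $\lambda$-Latin square. It is simple if no symbol is repeated in any cell. For $\ell\in[n]$, $i\in[r]$, $j\in[s]$, $|M_\ell|$, $|M^i_\ell|$, $|{}^jM_\ell|$ denote the number of occurrences of $\ell$ in $M$, in row $i$ of $M$, and in column $j$ of $M$, respectively. $M$ is extended to an $n\times n$ $\lambda$-Latin square $N$ if $M$ is the top left $r\times s$ subarray of $N$. *)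

theory Defs
  imports Complex_Main "HOL-Library.Multiset"
begin

text \<open>An \<open>r \<times> s\<close> array of multisets is a function of the row and the column index. Only its
  values at \<open>(i, j)\<close> with \<open>i \<in> {1..r}\<close> and \<open>j \<in> {1..s}\<close> matter; the values elsewhere are
  never referred to, so the dimensions are passed explicitly.\<close>

type_synonym mset_array = "nat \<Rightarrow> nat \<Rightarrow> nat multiset"

definition row_occ :: "nat \<Rightarrow> mset_array \<Rightarrow> nat \<Rightarrow> nat \<Rightarrow> nat" where
  "row_occ s M i l = (\<Sum>j\<in>{1..s}. count (M i j) l)"

definition col_occ :: "nat \<Rightarrow> mset_array \<Rightarrow> nat \<Rightarrow> nat \<Rightarrow> nat" where
  "col_occ r M j l = (\<Sum>i\<in>{1..r}. count (M i j) l)"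

definition total_occ :: "nat \<Rightarrow> nat \<Rightarrow> mset_array \<Rightarrow> nat \<Rightarrow> nat" where
  "total_occ r s M l = (\<Sum>i\<in>{1..r}. \<Sum>j\<in>{1..s}. count (M i j) l)"

definition latin_rectangle :: "nat \<Rightarrow> nat \<Rightarrow> nat \<Rightarrow> nat \<Rightarrow> mset_array \<Rightarrow> bool" where
  "latin_rectangle lam n r s M \<longleftrightarrow>
     (\<forall>i\<in>{1..r}. \<forall>j\<in>{1..s}. size (M i j) = lam \<and> set_mset (M i j) \<subseteq> {1..n}) \<and>
     (\<forall>i\<in>{1..r}. \<forall>l\<in>{1..n}. row_occ s M i l \<le> lam) \<and>
     (\<forall>j\<in>{1..s}. \<forall>l\<in>{1..n}. col_occ r M j l \<le> lam)"

definition latin_square :: "nat \<Rightarrow> nat \<Rightarrow> mset_array \<Rightarrow> bool" where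
  "latin_square lam n N \<longleftrightarrow> latin_rectangle lam n n n N"

definition simple_array :: "nat \<Rightarrow> nat \<Rightarrow> mset_array \<Rightarrow> bool" where
  "simple_array r s M \<longleftrightarrow> (\<forall>i\<in>{1..r}. \<forall>j\<in>{1..s}. \<forall>l. count (M i j) l \<le> 1)"

definition top_left_subarray :: "nat \<Rightarrow> nat \<Rightarrow> mset_array \<Rightarrow> mset_array \<Rightarrow> bool" where
  "top_left_subarray r s M N \<longleftrightarrow> (\<forall>i\<in>{1..r}. \<forall>j\<in>{1..s}. M i j = N i j)"

end

theory Submission
  imports Defs "HOL-Library.Transitive_Closure_Table"
begin

text \<open>The conditions are necessary by counting (\<open>row_occ_prefix_ge\<close>, \<open>total_occ_corner_bounds\<close>): in
a simple square every symbol occurs \<open>lam\<close> times in each row and column and at most once in each cell.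
The lower bound on \<open>row_occ\<close> says that row \<open>i\<close> has room in its remaining cells for the copies of
\<open>l\<close> that it lacks, and the two bounds on \<open>total_occ\<close> say that the number of copies of \<open>l\<close> that are
left for the bottom right corner is neither negative nor larger than that corner.

Conversely, the row and total conditions are what is needed to fill in all missing columns, treating
the missing rows as one merged row that only records how many copies of each symbol a new column
still has to receive below the rectangle (\<open>extend_by_columns\<close>). The required numbers of copies, indexed by
rows and symbols, form an integer matrix whose row sums, column sums and entry bounds are all
multiples of the number \<open>k\<close> of new columns. Dividing by \<open>k\<close> gives a fractional solution for one
column, and integrality of flows in bipartite networks turns it into an integral decomposition
of the matrix into \<open>k\<close> columns (\<open>matrix_equitable_decomposition\<close>). The resulting array has complete
rows, and together with the given column condition this makes its transpose satisfy the same
conditions, so a second application of the same step fills in the missing rows (\<open>extend_to_square\<close>).\<close>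

section \<open>Integral flows in a finite network\<close>

definition net_flow :: "'v set \<Rightarrow> ('v \<Rightarrow> 'v \<Rightarrow> int) \<Rightarrow> 'v \<Rightarrow> int" where
  "net_flow V g v = (\<Sum>w\<in>V. g v w - g w v)"

text \<open>The arcs along which one more unit can be sent without violating the bounds \<open>lo \<le> g \<le> hi\<close>:
either the flow on \<open>(u, w)\<close> is raised or the flow on the reverse arc \<open>(w, u)\<close> is lowered.\<close>

definition residual :: "'v set \<Rightarrow> ('v \<Rightarrow> 'v \<Rightarrow> int) \<Rightarrow> ('v \<Rightarrow> 'v \<Rightarrow> int) \<Rightarrow> ('v \<Rightarrow> 'v \<Rightarrow> int) \<Rightarrow> 'v \<Rightarrow> 'v \<Rightarrow> bool"
  where "residual V lo hi g u w \<longleftrightarrow> u \<in> V \<and> w \<in> V \<and> (g u w < hi u w \<or> lo w u < g w u)"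

definition feasible :: "'v set \<Rightarrow> ('v \<Rightarrow> 'v \<Rightarrow> int) \<Rightarrow> ('v \<Rightarrow> 'v \<Rightarrow> int) \<Rightarrow> ('v \<Rightarrow> 'v \<Rightarrow> int) \<Rightarrow> bool"
  where "feasible V lo hi g \<longleftrightarrow> (\<forall>u\<in>V. \<forall>w\<in>V. lo u w \<le> g u w \<and> g u w \<le> hi u w)"

text \<open>Flow between two vertices of \<open>S\<close> contributes once with each sign and cancels.\<close>

lemma sum_net_flow_eq_cut:
  assumes "finite V" "S \<subseteq> V"
  shows "(\<Sum>v\<in>S. net_flow V g v) = (\<Sum>v\<in>S. \<Sum>w\<in>V - S. g v w - g w v)"
proof -
  have split: "(\<Sum>w\<in>V. f w) = (\<Sum>w\<in>V - S. f w) + (\<Sum>w\<in>S. f w)" for f :: "'a \<Rightarrow> int"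
    using sum.subset_diff[OF assms(2,1)] .
  have "(\<Sum>v\<in>S. \<Sum>w\<in>S. g v w - g w v) = 0"
    by (simp add: sum_subtractf) (rule sum.swap)
  then show ?thesis
    unfolding net_flow_def split by (simp add: sum.distrib)
qed

text \<open>Only arcs incident with \<open>x\<close> change. Hence the part of a repetition-free residual path that
follows \<open>x\<close> is still residual after the push, which is what allows one to push along a whole
path by induction in \<open>augment_along_path\<close>.\<close>

lemma push_along_residual_arc:
  assumes "finite V" "feasible V lo hi g" "residual V lo hi g x z" "x \<noteq> z"
  obtains g' where "feasible V lo hi g'"
    "\<And>v. v \<in> V \<Longrightarrow> net_flow V g' v = net_flow V g v + of_bool (v = x) - of_bool (v = z)"
    "\<And>u w. u \<noteq> x \<Longrightarrow> w \<noteq> x \<Longrightarrow> g' u w = g u w"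
proof -
  have xz: "x \<in> V" "z \<in> V" using assms(3) by (auto simp: residual_def)
  define upd where "upd p q c = (\<lambda>u w. g u w + (if u = p \<and> w = q then c else 0))" for p q and c :: int
  have net: "net_flow V (upd p q c) v = net_flow V g v + c * (of_bool (v = p) - of_bool (v = q))"
    if "p \<in> V" "q \<in> V" "v \<in> V" for p q c v
  proof -
    have "net_flow V (upd p q c) v = net_flow V g v
        + (\<Sum>w\<in>V. if w = q then (if v = p then c else 0) else 0)
        - (\<Sum>w\<in>V. if w = p then (if v = q then c else 0) else 0)"
      unfolding net_flow_def upd_def sum.distrib[symmetric] sum_subtractf[symmetric]
      by (rule sum.cong) auto
    then show ?thesis using assms(1) that by (auto simp: sum.delta)
  qed
  show thesis
  proof (cases "g x z < hi x z")
    case True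
    show thesis
    proof (rule that[of "upd x z 1"])
      show "feasible V lo hi (upd x z 1)"
        using assms(2) True by (force simp: feasible_def upd_def)
    qed (use net[OF xz, of _ 1] in \<open>auto simp: upd_def\<close>)
  next
    case False
    then have "lo z x < g z x" using assms(3) by (auto simp: residual_def)
    show thesis
    proof (rule that[of "upd z x (-1)"])
      show "feasible V lo hi (upd z x (-1))"
        using assms(2) \<open>lo z x < g z x\<close> by (force simp: feasible_def upd_def)
    qed (use net[OF xz(2,1), of _ "-1"] in \<open>auto simp: upd_def\<close>)
  qed
qed

lemma augment_along_path:
  assumes "finite V" "feasible V lo hi g" "rtrancl_path (residual V lo hi g) x xs y" "distinct (x # xs)"
  shows "\<exists>g'. feasible V lo hi g' \<and>
    (\<forall>v\<in>V. net_flow V g' v = net_flow V g v + of_bool (v = x) - of_bool (v = y))"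
  using assms
proof (induction xs arbitrary: x g)
  case Nil
  then have "y = x" by (auto elim: rtrancl_path.cases)
  with Nil show ?case by auto
next
  case (Cons z zs)
  from Cons.prems(3) have res: "residual V lo hi g x z"
    and path: "rtrancl_path (residual V lo hi g) z zs y"
    by (auto elim: rtrancl_path.cases)
  have "x \<noteq> z" using Cons.prems(4) by auto
  from push_along_residual_arc[OF Cons.prems(1,2) res this] obtain g1 where
    g1: "feasible V lo hi g1"
      "\<And>v. v \<in> V \<Longrightarrow> net_flow V g1 v = net_flow V g v + of_bool (v = x) - of_bool (v = z)"
      "\<And>u w. u \<noteq> x \<Longrightarrow> w \<noteq> x \<Longrightarrow> g1 u w = g u w" by metis
  have "rtrancl_path (residual V lo hi g1) z zs y"
    if "x \<notin> set (z # zs)"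
    using path that
  proof (induction rule: rtrancl_path.induct)
    case (step a b bs c)
    then show ?case by (auto intro!: rtrancl_path.step simp: residual_def g1(3))
  qed (rule rtrancl_path.base)
  then have "rtrancl_path (residual V lo hi g1) z zs y" using Cons.prems(4) by simp
  from Cons.IH[OF Cons.prems(1) g1(1) this] Cons.prems(4) obtain g' where
    "feasible V lo hi g'"
    "\<forall>v\<in>V. net_flow V g' v = net_flow V g1 v + of_bool (v = z) - of_bool (v = y)" by auto
  with g1(2) show ?case by (intro exI[of _ g']) auto
qed

text \<open>If \<open>a / k\<close> is a fractional flow within the integer bounds \<open>lo\<close>, \<open>hi\<close> and with integer net flows \<open>d\<close>,
then there is an integral one; stating this for the scaled flow \<open>a\<close> keeps everything in the
integers. Take a feasible \<open>g\<close> with the least total deviation from \<open>d\<close>, and suppose that some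
vertex \<open>x\<close> sends out less than \<open>d x\<close>. By minimality no vertex of the set \<open>S\<close> reachable from \<open>x\<close>
in the residual network sends out too much, since augmenting along a path to it would reduce the
deviation. So the net flow of \<open>g\<close> out of \<open>S\<close> is less than the demand. But \<open>g\<close> is extremal on all
arcs crossing the boundary of \<open>S\<close>, hence sends out of \<open>S\<close> at least as much as \<open>a / k\<close>, which
meets the demand. The net flows sum to \<open>0\<close> over all vertices, so with no vertex below its demand
none is above it.\<close>

lemma integral_flow_exists:
  fixes k :: int and d :: "'v \<Rightarrow> int"
  assumes V: "finite V" and "k > 0"
    and lower: "\<And>u w. u \<in> V \<Longrightarrow> w \<in> V \<Longrightarrow> k * lo u w \<le> a u w"
    and upper: "\<And>u w. u \<in> V \<Longrightarrow> w \<in> V \<Longrightarrow> a u w \<le> k * hi u w"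
    and net_a: "\<And>v. v \<in> V \<Longrightarrow> net_flow V a v = k * d v"
  shows "\<exists>g. feasible V lo hi g \<and> (\<forall>v\<in>V. net_flow V g v = d v)"
proof -
  define defect where "defect g = (\<Sum>v\<in>V. nat \<bar>d v - net_flow V g v\<bar>)" for g
  have "k * lo u w \<le> k * hi u w" if "u \<in> V" "w \<in> V" for u w
    using lower[OF that] upper[OF that] by linarith
  then have "feasible V lo hi lo" using \<open>k > 0\<close> by (auto simp: feasible_def)
  from ex_has_least_nat[of "feasible V lo hi", OF this, of defect] obtain g where
    g: "feasible V lo hi g" and least: "\<And>h. feasible V lo hi h \<Longrightarrow> defect g \<le> defect h" by blast
  have sum_d: "k * (\<Sum>v\<in>S. d v) = (\<Sum>v\<in>S. \<Sum>w\<in>V - S. a v w - a w v)" if "S \<subseteq> V" for S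
  proof -
    have "k * (\<Sum>v\<in>S. d v) = (\<Sum>v\<in>S. net_flow V a v)"
      unfolding sum_distrib_left using net_a that by (intro sum.cong) auto
    then show ?thesis using sum_net_flow_eq_cut[OF V that] by simp
  qed
  have no_deficit: "\<not> net_flow V g x < d x" if x: "x \<in> V" for x
  proof
    assume deficit: "net_flow V g x < d x"
    define S where "S = {y. (residual V lo hi g)\<^sup>*\<^sup>* x y}"
    have "S \<subseteq> V"
      unfolding S_def using x by (auto elim: rtranclp.cases simp: residual_def)
    have fin: "finite S" using V \<open>S \<subseteq> V\<close> finite_subset by blast
    have "x \<in> S" by (simp add: S_def)
    have "net_flow V g y \<le> d y" if y: "y \<in> S" for y
    proof (rule ccontr)
      assume surplus: "\<not> net_flow V g y \<le> d y"
      from y obtain xs where "rtrancl_path (residual V lo hi g) x xs y"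
        unfolding S_def by (auto simp: rtranclp_eq_rtrancl_path)
      then obtain ys where "rtrancl_path (residual V lo hi g) x ys y" "distinct (x # ys)"
        by (rule rtrancl_path_distinct)
      from augment_along_path[OF V g this] obtain h where h: "feasible V lo hi h"
        and net_h: "\<And>v. v \<in> V \<Longrightarrow> net_flow V h v = net_flow V g v + of_bool (v = x) - of_bool (v = y)"
        by blast
      have "defect h < defect g"
        unfolding defect_def
      proof (rule sum_strict_mono_ex1)
        show "\<forall>v\<in>V. nat \<bar>d v - net_flow V h v\<bar> \<le> nat \<bar>d v - net_flow V g v\<bar>"
          using net_h deficit surplus by (auto simp: of_bool_def)
        show "\<exists>v\<in>V. nat \<bar>d v - net_flow V h v\<bar> < nat \<bar>d v - net_flow V g v\<bar>"
          using net_h[OF x] deficit surplus x by (intro bexI[of _ x]) (auto simp: of_bool_def)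
      qed (rule V)
      with least[OF h] show False by simp
    qed
    then have "(\<Sum>v\<in>S. net_flow V g v) < (\<Sum>v\<in>S. d v)"
      using deficit \<open>x \<in> S\<close> fin by (intro sum_strict_mono_ex1) auto
    then have "k * (\<Sum>v\<in>S. \<Sum>w\<in>V - S. g v w - g w v) < k * (\<Sum>v\<in>S. d v)"
      using \<open>k > 0\<close> sum_net_flow_eq_cut[OF V \<open>S \<subseteq> V\<close>, of g] by simp
    moreover have "a v w - a w v \<le> k * (g v w - g w v)" if "v \<in> S" "w \<in> V - S" for v w
    proof -
      have "\<not> residual V lo hi g v w"
        using that by (auto simp: S_def intro: rtranclp.rtrancl_into_rtrancl)
      then have "g v w \<ge> hi v w" "g w v \<le> lo w v"
        using that \<open>S \<subseteq> V\<close> by (auto simp: residual_def)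
      then have "k * hi v w \<le> k * g v w" "k * g w v \<le> k * lo w v"
        using \<open>k > 0\<close> by simp_all
      then show ?thesis
        using lower[of w v] upper[of v w] that \<open>S \<subseteq> V\<close> by (auto simp: right_diff_distrib)
    qed
    then have "(\<Sum>v\<in>S. \<Sum>w\<in>V - S. a v w - a w v) \<le> k * (\<Sum>v\<in>S. \<Sum>w\<in>V - S. g v w - g w v)"
      unfolding sum_distrib_left by (intro sum_mono) auto
    ultimately show False using sum_d[OF \<open>S \<subseteq> V\<close>] by simp
  qed
  have "(\<Sum>v\<in>V. net_flow V g v - d v) = 0"
    using sum_d[of V] sum_net_flow_eq_cut[OF V, of V g] \<open>k > 0\<close> by (simp add: sum_subtractf)
  then have "\<forall>v\<in>V. net_flow V g v - d v = 0"
    using no_deficit V by (subst (asm) sum_nonneg_eq_0_iff) (auto simp: not_less)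
  with g show ?thesis by auto
qed

section \<open>Decomposition of integer matrices\<close>

text \<open>The bipartite case of \<open>integral_flow_exists\<close>: matrix entries are the flow from rows to columns,
and all other arcs have both bounds equal to \<open>0\<close>.\<close>

lemma integral_matrix_exists:
  fixes k :: int and \<rho> :: "'a \<Rightarrow> int" and \<gamma> :: "'b \<Rightarrow> int" and A lo hi :: "'a \<Rightarrow> 'b \<Rightarrow> int"
  assumes "finite R" "finite C" "k > 0"
    and "\<And>i j. i \<in> R \<Longrightarrow> j \<in> C \<Longrightarrow> k * lo i j \<le> A i j \<and> A i j \<le> k * hi i j"
    and "\<And>i. i \<in> R \<Longrightarrow> (\<Sum>j\<in>C. A i j) = k * \<rho> i"
    and "\<And>j. j \<in> C \<Longrightarrow> (\<Sum>i\<in>R. A i j) = k * \<gamma> j"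
  shows "\<exists>B. (\<forall>i\<in>R. \<forall>j\<in>C. lo i j \<le> B i j \<and> B i j \<le> hi i j) \<and>
    (\<forall>i\<in>R. (\<Sum>j\<in>C. B i j) = \<rho> i) \<and> (\<forall>j\<in>C. (\<Sum>i\<in>R. B i j) = \<gamma> j)"
proof -
  define arcs where "arcs X u w = (case (u, w) of (Inl i, Inr j) \<Rightarrow> X i j | _ \<Rightarrow> 0)"
    for X :: "'a \<Rightarrow> 'b \<Rightarrow> int" and u w :: "'a + 'b"
  let ?V = "R <+> C"
  define d where "d v = (case v of Inl i \<Rightarrow> \<rho> i | Inr j \<Rightarrow> - \<gamma> j)" for v
  have sum_V: "(\<Sum>w\<in>?V. f w) = (\<Sum>i\<in>R. f (Inl i)) + (\<Sum>j\<in>C. f (Inr j))" for f :: "'a + 'b \<Rightarrow> int"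
    using assms(1,2) by (simp add: sum.Plus)
  have "\<exists>g. feasible ?V (arcs lo) (arcs hi) g \<and> (\<forall>v\<in>?V. net_flow ?V g v = d v)"
  proof (rule integral_flow_exists[where k = k and a = "arcs A"])
    show "net_flow ?V (arcs A) v = k * d v" if "v \<in> ?V" for v
      using that assms(5,6) unfolding net_flow_def sum_V
      by (auto simp: arcs_def d_def sum_negf)
  qed (use assms(1-4) in \<open>auto simp: arcs_def split: sum.split\<close>)
  then obtain g where g: "feasible ?V (arcs lo) (arcs hi) g" and net: "\<forall>v\<in>?V. net_flow ?V g v = d v"
    by blast
  have zero: "i \<in> R \<Longrightarrow> i' \<in> R \<Longrightarrow> g (Inl i) (Inl i') = 0"
    "j \<in> C \<Longrightarrow> j' \<in> C \<Longrightarrow> g (Inr j) (Inr j') = 0"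
    "i \<in> R \<Longrightarrow> j \<in> C \<Longrightarrow> g (Inr j) (Inl i) = 0" for i i' j j'
    using g by (force simp: feasible_def arcs_def)+
  have "(\<Sum>j\<in>C. g (Inl i) (Inr j)) = \<rho> i" if "i \<in> R" for i
    using net[rule_format, of "Inl i"] that unfolding net_flow_def sum_V
    by (auto simp: d_def zero)
  moreover have "(\<Sum>i\<in>R. g (Inl i) (Inr j)) = \<gamma> j" if "j \<in> C" for j
    using net[rule_format, of "Inr j"] that unfolding net_flow_def sum_V
    by (auto simp: d_def zero sum_negf)
  moreover have "lo i j \<le> g (Inl i) (Inr j) \<and> g (Inl i) (Inr j) \<le> hi i j" if "i \<in> R" "j \<in> C" for i j
    using g that by (force simp: feasible_def arcs_def)
  ultimately show ?thesis by (intro exI[of _ "\<lambda>i j. g (Inl i) (Inr j)"]) auto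
qed

text \<open>The summands are peeled off one at a time. A first summand must leave a remainder that lies
between \<open>0\<close> and \<open>(k - 1) * u\<close>, and this interval condition on integers is met by the fractional
matrix \<open>A / k\<close>, which also has the right row and column sums; so an integral choice exists as
well. Bounding the entries separately from the row and column sums is essential: it is what
keeps cells simple when the rows stand for rows of an array and the columns for symbols.\<close>

lemma matrix_equitable_decomposition:
  fixes k :: nat and A u :: "'a \<Rightarrow> 'b \<Rightarrow> int" and \<rho> :: "'a \<Rightarrow> int" and \<gamma> :: "'b \<Rightarrow> int"
  assumes "finite R" "finite C"
    and "\<And>i j. i \<in> R \<Longrightarrow> j \<in> C \<Longrightarrow> 0 \<le> A i j \<and> A i j \<le> int k * u i j"
    and "\<And>i. i \<in> R \<Longrightarrow> (\<Sum>j\<in>C. A i j) = int k * \<rho> i"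
    and "\<And>j. j \<in> C \<Longrightarrow> (\<Sum>i\<in>R. A i j) = int k * \<gamma> j"
  shows "\<exists>B. (\<forall>t<k. (\<forall>i\<in>R. \<forall>j\<in>C. 0 \<le> B t i j \<and> B t i j \<le> u i j) \<and>
      (\<forall>i\<in>R. (\<Sum>j\<in>C. B t i j) = \<rho> i) \<and> (\<forall>j\<in>C. (\<Sum>i\<in>R. B t i j) = \<gamma> j)) \<and>
    (\<forall>i\<in>R. \<forall>j\<in>C. (\<Sum>t<k. B t i j) = A i j)"
  using assms(3-)
proof (induction k arbitrary: A)
  case 0
  then show ?case by force
next
  case (Suc k)
  \<comment> \<open>The terms with \<open>A\<close> express that the remainder \<open>A - B0\<close> is at most \<open>k * u\<close> and is nonnegative.\<close>
  define lo where "lo i j = max 0 (A i j - int k * u i j)" for i j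
  define hi where "hi i j = min (u i j) (A i j)" for i j
  have bounds: "int (Suc k) * lo i j \<le> A i j \<and> A i j \<le> int (Suc k) * hi i j" if "i \<in> R" "j \<in> C" for i j
  proof -
    have *: "0 \<le> A i j" "A i j \<le> (1 + int k) * u i j" using Suc.prems(1)[OF that] by auto
    then have "int k * A i j \<le> int k * ((1 + int k) * u i j)" by (intro mult_left_mono) auto
    moreover have "0 \<le> int k * A i j" using * by simp
    ultimately show ?thesis using *
      by (auto simp: lo_def hi_def max_def min_def algebra_simps)
  qed
  have "\<exists>B0. (\<forall>i\<in>R. \<forall>j\<in>C. lo i j \<le> B0 i j \<and> B0 i j \<le> hi i j) \<and>
    (\<forall>i\<in>R. (\<Sum>j\<in>C. B0 i j) = \<rho> i) \<and> (\<forall>j\<in>C. (\<Sum>i\<in>R. B0 i j) = \<gamma> j)"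
    by (rule integral_matrix_exists[where k = "int (Suc k)" and A = A])
      (use assms(1,2) bounds Suc.prems(2,3) in simp_all)
  then obtain B0 where B0: "\<And>i j. i \<in> R \<Longrightarrow> j \<in> C \<Longrightarrow> lo i j \<le> B0 i j \<and> B0 i j \<le> hi i j"
    "\<And>i. i \<in> R \<Longrightarrow> (\<Sum>j\<in>C. B0 i j) = \<rho> i" "\<And>j. j \<in> C \<Longrightarrow> (\<Sum>i\<in>R. B0 i j) = \<gamma> j"
    by blast
  have "\<exists>B. (\<forall>t<k. (\<forall>i\<in>R. \<forall>j\<in>C. 0 \<le> B t i j \<and> B t i j \<le> u i j) \<and>
      (\<forall>i\<in>R. (\<Sum>j\<in>C. B t i j) = \<rho> i) \<and> (\<forall>j\<in>C. (\<Sum>i\<in>R. B t i j) = \<gamma> j)) \<and>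
    (\<forall>i\<in>R. \<forall>j\<in>C. (\<Sum>t<k. B t i j) = A i j - B0 i j)"
  proof (rule Suc.IH)
    show "0 \<le> A i j - B0 i j \<and> A i j - B0 i j \<le> int k * u i j" if "i \<in> R" "j \<in> C" for i j
      using B0(1)[OF that] by (auto simp: lo_def hi_def)
  qed (use Suc.prems(2,3) B0(2,3) in \<open>auto simp: sum_subtractf algebra_simps\<close>)
  then obtain B where B: "\<forall>t<k. (\<forall>i\<in>R. \<forall>j\<in>C. 0 \<le> B t i j \<and> B t i j \<le> u i j) \<and>
      (\<forall>i\<in>R. (\<Sum>j\<in>C. B t i j) = \<rho> i) \<and> (\<forall>j\<in>C. (\<Sum>i\<in>R. B t i j) = \<gamma> j)"
    "\<forall>i\<in>R. \<forall>j\<in>C. (\<Sum>t<k. B t i j) = A i j - B0 i j" by blast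
  have "0 \<le> B0 i j \<and> B0 i j \<le> u i j" if "i \<in> R" "j \<in> C" for i j
    using B0(1)[OF that] by (auto simp: lo_def hi_def)
  with B B0(2,3) show ?case
    by (intro exI[of _ "B(k := B0)"]) (auto simp: less_Suc_eq)
qed

section \<open>Occurrence counts in Latin rectangles\<close>

lemma sum_count_eq_size:
  assumes "finite A" "set_mset X \<subseteq> A"
  shows "(\<Sum>l\<in>A. count X l) = size X"
  unfolding size_multiset_overloaded_eq using assms
  by (intro sum.mono_neutral_right) (auto simp: not_in_iff)

lemma sum_row_occ:
  assumes "latin_rectangle lam n r s M" "i \<in> {1..r}"
  shows "(\<Sum>l\<in>{1..n}. row_occ s M i l) = s * lam"
proof -
  have "(\<Sum>l\<in>{1..n}. row_occ s M i l) = (\<Sum>j\<in>{1..s}. \<Sum>l\<in>{1..n}. count (M i j) l)"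
    unfolding row_occ_def by (rule sum.swap)
  also have "\<dots> = (\<Sum>j\<in>{1..s}. lam)"
    using assms by (intro sum.cong) (auto simp: latin_rectangle_def sum_count_eq_size)
  finally show ?thesis by simp
qed

lemma total_occ_eq_sum_row_occ: "total_occ r s M l = (\<Sum>i\<in>{1..r}. row_occ s M i l)"
  by (simp add: total_occ_def row_occ_def)

text \<open>A row of full length has \<open>n * lam\<close> places for \<open>n\<close> symbols, each used at most \<open>lam\<close> times, so
every bound is attained.\<close>

lemma row_occ_full:
  assumes "latin_rectangle lam n r n M" "i \<in> {1..r}" "l \<in> {1..n}"
  shows "row_occ n M i l = lam"
proof -
  have "(\<Sum>l\<in>{1..n}. row_occ n M i l) = (\<Sum>l\<in>{1..n}. lam)"
    using sum_row_occ[OF assms(1,2)] by simp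
  then show ?thesis
    by (rule sum_mono_inv[where I = "{1..n}"]) (use assms in \<open>auto simp: latin_rectangle_def\<close>)
qed

lemma row_occ_transpose: "row_occ s (\<lambda>i j. M j i) i l = col_occ s M i l"
  by (simp add: row_occ_def col_occ_def)

lemma col_occ_transpose: "col_occ s (\<lambda>i j. M j i) i l = row_occ s M i l"
  by (simp add: row_occ_def col_occ_def)

lemma total_occ_transpose: "total_occ s r (\<lambda>i j. M j i) l = total_occ r s M l"
  unfolding total_occ_def by (rule sum.swap)

lemma latin_rectangle_transpose:
  "latin_rectangle lam n r s M \<Longrightarrow> latin_rectangle lam n s r (\<lambda>i j. M j i)"
  by (simp add: latin_rectangle_def row_occ_def col_occ_def)

lemma simple_array_transpose: "simple_array r s M \<Longrightarrow> simple_array s r (\<lambda>i j. M j i)"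
  by (simp add: simple_array_def)

lemma sum_split_at:
  fixes f :: "nat \<Rightarrow> 'a :: comm_monoid_add"
  assumes "s \<le> n"
  shows "(\<Sum>j\<in>{1..n}. f j) = (\<Sum>j\<in>{1..s}. f j) + (\<Sum>j\<in>{s+1..n}. f j)"
proof -
  have "{1..n} = {1..s} \<union> {s+1..n}" using assms by auto
  then show ?thesis by (simp add: sum.union_disjoint)
qed

section \<open>Extending a rectangle to a square\<close>

text \<open>The missing \<open>n - r\<close> rows are merged into a single row with index \<open>0\<close>. The integer \<open>A i l\<close> is the
number of copies of \<open>l\<close> that row \<open>i\<close> has to receive within the \<open>n - s\<close> new columns; for the merged
row this number is forced, because all in all the new columns contain \<open>lam * (n - s)\<close> copies of \<open>l\<close>.
The bounds on \<open>row_occ\<close> and \<open>total_occ\<close> say precisely that \<open>A\<close> lies between \<open>0\<close> and \<open>n - s\<close> times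
the capacity \<open>u\<close> of one new column, which is \<open>1\<close> for an ordinary row and \<open>n - r\<close> for the merged one.
Decomposing \<open>A\<close> equitably into \<open>n - s\<close> summands gives the contents of the new columns. The entries
in the merged row guarantee that a new column lacks at most \<open>n - r\<close> copies of each symbol, which
is the condition under which the remaining rows can be filled in later.\<close>

lemma extend_by_columns:
  assumes "r \<le> n" "s \<le> n"
    and lat: "latin_rectangle lam n r s M" and simple: "simple_array r s M"
    and total: "\<And>l. l \<in> {1..n} \<Longrightarrow>
       int lam * (int r + int s - int n) \<le> int (total_occ r s M l) \<and>
       int (total_occ r s M l) \<le>
         int lam * (int r + int s - int n) + (int n - int r) * (int n - int s)"
    and row: "\<And>i l. i \<in> {1..r} \<Longrightarrow> l \<in> {1..n} \<Longrightarrow> int (row_occ s M i l) \<ge> int lam + int s - int n"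
    and col: "\<And>j l. j \<in> {1..s} \<Longrightarrow> l \<in> {1..n} \<Longrightarrow> int (col_occ r M j l) \<ge> int lam + int r - int n"
  obtains M' where "latin_rectangle lam n r n M'" "simple_array r n M'" "top_left_subarray r s M M'"
    "\<And>j l. j \<in> {1..n} \<Longrightarrow> l \<in> {1..n} \<Longrightarrow> int (col_occ r M' j l) \<ge> int lam + int r - int n"
proof -
  \<comment> \<open>Index \<open>0\<close> is free to denote the merged row since the rows of the array are numbered from \<open>1\<close>.\<close>
  define A where "A i l = (if i = 0 then int lam * (int n - int r - int s) + int (total_occ r s M l)
    else int lam - int (row_occ s M i l))" for i l
  define u where "u i l = (if i = 0 then int n - int r else 1)" for i l :: nat
  define \<rho> where "\<rho> i = (if i = 0 then int lam * (int n - int r) else int lam)" for i :: nat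
  have rows: "{0..r} = insert 0 {1..r}" by auto
  have k: "int (n - s) = int n - int s" using assms(2) by simp
  have "\<exists>B. (\<forall>t<n - s. (\<forall>i\<in>{0..r}. \<forall>l\<in>{1..n}. 0 \<le> B t i l \<and> B t i l \<le> u i l) \<and>
      (\<forall>i\<in>{0..r}. (\<Sum>l\<in>{1..n}. B t i l) = \<rho> i) \<and>
      (\<forall>l\<in>{1..n}. (\<Sum>i\<in>{0..r}. B t i l) = int lam)) \<and>
    (\<forall>i\<in>{0..r}. \<forall>l\<in>{1..n}. (\<Sum>t<n - s. B t i l) = A i l)"
  proof (rule matrix_equitable_decomposition; (unfold k)?)
    show "0 \<le> A i l \<and> A i l \<le> (int n - int s) * u i l" if "i \<in> {0..r}" "l \<in> {1..n}" for i l
    proof (cases "i = 0")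
      case True
      with total[OF that(2)] show ?thesis by (simp add: A_def u_def algebra_simps)
    next
      case False
      with that have "i \<in> {1..r}" by auto
      with row[of i l] lat that False show ?thesis
        by (auto simp: A_def u_def latin_rectangle_def)
    qed
    show "(\<Sum>l\<in>{1..n}. A i l) = (int n - int s) * \<rho> i" if "i \<in> {0..r}" for i
    proof (cases "i = 0")
      case True
      have "(\<Sum>l\<in>{1..n}. total_occ r s M l) = (\<Sum>i\<in>{1..r}. \<Sum>l\<in>{1..n}. row_occ s M i l)"
        unfolding total_occ_eq_sum_row_occ by (rule sum.swap)
      also have "\<dots> = r * (s * lam)" using sum_row_occ[OF lat] by simp
      finally have "(\<Sum>l\<in>{1..n}. int (total_occ r s M l)) = int r * (int s * int lam)"
        by (simp flip: of_nat_sum of_nat_mult)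
      with True show ?thesis by (simp add: A_def \<rho>_def sum.distrib) (simp add: algebra_simps)
    next
      case False
      with that have "i \<in> {1..r}" by auto
      from sum_row_occ[OF lat this] have "(\<Sum>l\<in>{1..n}. int (row_occ s M i l)) = int s * int lam"
        by (simp flip: of_nat_sum of_nat_mult)
      with False show ?thesis by (simp add: A_def \<rho>_def sum_subtractf algebra_simps)
    qed
    show "(\<Sum>i\<in>{0..r}. A i l) = (int n - int s) * int lam" if "l \<in> {1..n}" for l
    proof -
      have "(\<Sum>i\<in>{1..r}. A i l) = (\<Sum>i\<in>{1..r}. int lam - int (row_occ s M i l))"
        by (intro sum.cong) (auto simp: A_def)
      also have "\<dots> = int r * int lam - int (total_occ r s M l)"
        by (simp add: sum_subtractf total_occ_eq_sum_row_occ)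
      finally show ?thesis unfolding rows by (simp add: A_def algebra_simps)
    qed
  qed auto
  then obtain B where
    B: "\<And>t i l. t < n - s \<Longrightarrow> i \<in> {0..r} \<Longrightarrow> l \<in> {1..n} \<Longrightarrow> 0 \<le> B t i l \<and> B t i l \<le> u i l"
    and B_row: "\<And>t i. t < n - s \<Longrightarrow> i \<in> {0..r} \<Longrightarrow> (\<Sum>l\<in>{1..n}. B t i l) = \<rho> i"
    and B_col: "\<And>t l. t < n - s \<Longrightarrow> l \<in> {1..n} \<Longrightarrow> (\<Sum>i\<in>{0..r}. B t i l) = int lam"
    and B_sum: "\<And>i l. i \<in> {0..r} \<Longrightarrow> l \<in> {1..n} \<Longrightarrow> (\<Sum>t<n - s. B t i l) = A i l"
    by blast
  \<comment> \<open>Summand \<open>t\<close>, counted from \<open>0\<close>, becomes column \<open>s + 1 + t\<close>; its merged row is dropped.\<close>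
  define M' where "M' i j = (if j \<le> s then M i j
    else mset_set {l \<in> {1..n}. B (j - s - 1) i l = 1})" for i j
  have count_new: "int (count (M' i j) l) = B (j - s - 1) i l"
    if "i \<in> {1..r}" "j \<in> {s+1..n}" "l \<in> {1..n}" for i j l
  proof -
    have "0 \<le> B (j - s - 1) i l \<and> B (j - s - 1) i l \<le> 1"
      using B[of "j - s - 1" i l] that by (auto simp: u_def)
    then show ?thesis using that by (auto simp: M'_def count_mset_set')
  qed
  have set_new: "set_mset (M' i j) \<subseteq> {1..n}" if "j \<in> {s+1..n}" for i j
    using that by (auto simp: M'_def)
  have size_new: "size (M' i j) = lam" if "i \<in> {1..r}" "j \<in> {s+1..n}" for i j
  proof -
    have "int (size (M' i j)) = (\<Sum>l\<in>{1..n}. int (count (M' i j) l))"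
      using sum_count_eq_size[OF _ set_new[OF that(2)]] by (simp flip: of_nat_sum)
    also have "\<dots> = (\<Sum>l\<in>{1..n}. B (j - s - 1) i l)"
      using count_new[OF that] by simp
    also have "\<dots> = int lam"
      using B_row[of "j - s - 1" i] that by (auto simp: \<rho>_def)
    finally show ?thesis by simp
  qed
  have row_new: "row_occ n M' i l = lam" if "i \<in> {1..r}" "l \<in> {1..n}" for i l
  proof -
    have "int (row_occ n M' i l) = int (row_occ s M i l) + (\<Sum>j\<in>{s+1..n}. int (count (M' i j) l))"
      unfolding row_occ_def sum_split_at[OF assms(2)] by (simp add: M'_def)
    also have "(\<Sum>j\<in>{s+1..n}. int (count (M' i j) l)) = (\<Sum>j\<in>{s+1..n}. B (j - s - 1) i l)"
      using count_new[OF that(1) _ that(2)] by simp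
    also have "\<dots> = (\<Sum>t<n - s. B t i l)"
      by (rule sum.reindex_bij_witness[of _ "\<lambda>t. t + s + 1" "\<lambda>j. j - s - 1"]) auto
    also have "\<dots> = int lam - int (row_occ s M i l)"
      using B_sum[of i l] that by (simp add: A_def)
    finally show ?thesis by simp
  qed
  have col_old: "col_occ r M' j l = col_occ r M j l" if "j \<in> {1..s}" for j l
    using that by (simp add: col_occ_def M'_def)
  have col_new: "int lam + int r - int n \<le> int (col_occ r M' j l) \<and> col_occ r M' j l \<le> lam"
    if "j \<in> {s+1..n}" "l \<in> {1..n}" for j l
  proof -
    have t: "j - s - 1 < n - s" using that by auto
    have "int (col_occ r M' j l) = (\<Sum>i\<in>{1..r}. B (j - s - 1) i l)"
      using count_new[OF _ that] by (simp add: col_occ_def)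
    also have "\<dots> = int lam - B (j - s - 1) 0 l"
      using B_col[OF t that(2)] unfolding rows by simp
    finally show ?thesis using B[OF t _ that(2), of 0] by (simp add: u_def)
  qed
  have old_new: "j \<in> {1..s} \<or> j \<in> {s+1..n}" if "j \<in> {1..n}" for j
    using that by auto
  show thesis
  proof
    show "latin_rectangle lam n r n M'"
      unfolding latin_rectangle_def
    proof (intro conjI ballI)
      fix i j assume ij: "i \<in> {1..r}" "j \<in> {1..n}"
      have "size (M i j) = lam \<and> set_mset (M i j) \<subseteq> {1..n}" if "j \<in> {1..s}"
        using lat ij(1) that by (simp add: latin_rectangle_def)
      moreover have "M' i j = M i j" if "j \<in> {1..s}"
        using that by (simp add: M'_def)
      ultimately show "size (M' i j) = lam" "set_mset (M' i j) \<subseteq> {1..n}"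
        using old_new[OF ij(2)] size_new[OF ij(1)] set_new by metis+
    next
      fix j l assume jl: "j \<in> {1..n}" "l \<in> {1..n}"
      from old_new[OF jl(1)] show "col_occ r M' j l \<le> lam"
        using col_new[OF _ jl(2)] col_old lat jl(2) by (auto simp: latin_rectangle_def)
    qed (use row_new in simp)
    show "simple_array r n M'"
      unfolding simple_array_def
    proof (intro ballI allI)
      fix i j l assume ij: "i \<in> {1..r}" "j \<in> {1..n}"
      from old_new[OF ij(2)] show "count (M' i j) l \<le> 1"
        using simple ij(1) by (auto simp: M'_def simple_array_def count_mset_set')
    qed
    show "top_left_subarray r s M M'"
      by (simp add: top_left_subarray_def M'_def)
    show "int (col_occ r M' j l) \<ge> int lam + int r - int n" if "j \<in> {1..n}" "l \<in> {1..n}" for j l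
      using old_new[OF that(1)] col_new[OF _ that(2)] col_old col[OF _ that(2)] by auto
  qed
qed

text \<open>Once the \<open>r\<close> given rows are complete, the transposed array has \<open>r\<close> columns and all \<open>n\<close> rows. It
satisfies the hypotheses of \<open>extend_by_columns\<close> again: every symbol occurs exactly \<open>r * lam\<close> times in
it, which is both the lower and the upper bound on the total, and the bounds on its rows are the
column bounds delivered by the first extension. So the same lemma supplies the missing rows.\<close>

lemma extend_to_square:
  assumes "r \<le> n" "s \<le> n"
    and "latin_rectangle lam n r s M" "simple_array r s M"
    and "\<And>l. l \<in> {1..n} \<Longrightarrow>
       int lam * (int r + int s - int n) \<le> int (total_occ r s M l) \<and>
       int (total_occ r s M l) \<le>
         int lam * (int r + int s - int n) + (int n - int r) * (int n - int s)"
    and "\<And>i l. i \<in> {1..r} \<Longrightarrow> l \<in> {1..n} \<Longrightarrow> int (row_occ s M i l) \<ge> int lam + int s - int n"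
    and "\<And>j l. j \<in> {1..s} \<Longrightarrow> l \<in> {1..n} \<Longrightarrow> int (col_occ r M j l) \<ge> int lam + int r - int n"
  shows "\<exists>N. latin_square lam n N \<and> simple_array n n N \<and> top_left_subarray r s M N"
proof -
  obtain M1 where M1: "latin_rectangle lam n r n M1" "simple_array r n M1" "top_left_subarray r s M M1"
    "\<And>j l. j \<in> {1..n} \<Longrightarrow> l \<in> {1..n} \<Longrightarrow> int (col_occ r M1 j l) \<ge> int lam + int r - int n"
    using extend_by_columns[OF assms] by blast
  have row1: "row_occ n M1 i l = lam" if "i \<in> {1..r}" "l \<in> {1..n}" for i l
    by (rule row_occ_full[OF M1(1) that])
  have total1: "total_occ n r (\<lambda>i j. M1 j i) l = r * lam" if "l \<in> {1..n}" for l
    using row1 that by (simp add: total_occ_transpose[of _ _ M1] total_occ_eq_sum_row_occ)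
  obtain N where N: "latin_rectangle lam n n n N" "simple_array n n N"
    "top_left_subarray n r (\<lambda>i j. M1 j i) N"
    by (rule extend_by_columns[OF order_refl assms(1)
          latin_rectangle_transpose[OF M1(1)] simple_array_transpose[OF M1(2)]])
      (auto simp: total1 row1 row_occ_transpose[of _ M1] col_occ_transpose[of _ M1] M1(4))
  have "top_left_subarray r s M (\<lambda>i j. N j i)"
    using M1(3) N(3) assms(2) by (auto simp: top_left_subarray_def)
  with N(1,2) show ?thesis
    by (intro exI[of _ "\<lambda>i j. N j i"])
      (auto simp: latin_square_def intro: latin_rectangle_transpose simple_array_transpose)
qed

section \<open>Necessity of the counting conditions\<close>

text \<open>A row contains \<open>lam\<close> copies of \<open>l\<close>, and its last \<open>n - s\<close> cells hold at most one copy each.\<close>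

lemma row_occ_prefix_ge:
  assumes "s \<le> n" "latin_rectangle lam n r n N" "simple_array r n N" "i \<in> {1..r}" "l \<in> {1..n}"
  shows "int (row_occ s N i l) \<ge> int lam + int s - int n"
proof -
  have "(\<Sum>j\<in>{s+1..n}. count (N i j) l) \<le> (\<Sum>j\<in>{s+1..n}. 1)"
    using assms by (intro sum_mono) (auto simp: simple_array_def)
  moreover have "lam = row_occ s N i l + (\<Sum>j\<in>{s+1..n}. count (N i j) l)"
    using row_occ_full[OF assms(2,4,5)] unfolding row_occ_def sum_split_at[OF assms(1)] by simp
  ultimately have "lam \<le> row_occ s N i l + (n - s)" by simp
  then show ?thesis using assms(1) by simp
qed

text \<open>By inclusion and exclusion over the first \<open>r\<close> rows and the first \<open>s\<close> columns, the excess of the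
total over \<open>lam * (r + s - n)\<close> is the number of copies of \<open>l\<close> in the opposite corner, a block of
\<open>(n - r) * (n - s)\<close> cells with at most one copy each.\<close>

lemma total_occ_corner_bounds:
  assumes "r \<le> n" "s \<le> n" and lat: "latin_rectangle lam n n n N" and "simple_array n n N" "l \<in> {1..n}"
  shows "int lam * (int r + int s - int n) \<le> int (total_occ r s N l)"
    "int (total_occ r s N l) \<le> int lam * (int r + int s - int n) + (int n - int r) * (int n - int s)"
proof -
  define corner where "corner = (\<Sum>i\<in>{r+1..n}. \<Sum>j\<in>{s+1..n}. count (N i j) l)"
  have row: "(\<Sum>j\<in>{1..n}. count (N i j) l) = lam" if "i \<in> {1..n}" for i
    using row_occ_full[OF lat that assms(5)] by (simp add: row_occ_def)
  have col: "(\<Sum>i\<in>{1..n}. count (N i j) l) = lam" if "j \<in> {1..n}" for j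
    using row_occ_full[OF latin_rectangle_transpose[OF lat] that assms(5)]
    by (simp add: row_occ_def)
  have left: "(\<Sum>i\<in>{1..n}. \<Sum>j\<in>{1..s}. count (N i j) l) = s * lam"
    by (subst sum.swap) (use col assms(2) in simp)
  have top: "total_occ r s N l + (\<Sum>i\<in>{1..r}. \<Sum>j\<in>{s+1..n}. count (N i j) l) = r * lam"
  proof -
    have "(\<Sum>i\<in>{1..r}. \<Sum>j\<in>{1..n}. count (N i j) l) = r * lam" using row assms(1) by simp
    then show ?thesis unfolding sum_split_at[OF assms(2)] total_occ_def by (simp add: sum.distrib)
  qed
  have right: "(\<Sum>i\<in>{1..r}. \<Sum>j\<in>{s+1..n}. count (N i j) l) + corner + s * lam = n * lam"
  proof -
    have "n * lam = (\<Sum>i\<in>{1..n}. \<Sum>j\<in>{1..n}. count (N i j) l)" using row by simp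
    also have "\<dots> = (\<Sum>i\<in>{1..n}. (\<Sum>j\<in>{1..s}. count (N i j) l) + (\<Sum>j\<in>{s+1..n}. count (N i j) l))"
      by (intro sum.cong refl sum_split_at assms(2))
    also have "\<dots> = s * lam + (\<Sum>i\<in>{1..n}. \<Sum>j\<in>{s+1..n}. count (N i j) l)"
      by (simp only: sum.distrib left)
    finally show ?thesis unfolding sum_split_at[OF assms(1)] corner_def by simp
  qed
  have "corner \<le> (\<Sum>i\<in>{r+1..n}. \<Sum>j\<in>{s+1..n}. 1)"
    unfolding corner_def using assms(4) by (intro sum_mono) (auto simp: simple_array_def)
  then have "int corner \<le> int ((n - r) * (n - s))" unfolding of_nat_le_iff by simp
  then have "int corner \<le> (int n - int r) * (int n - int s)"
    using assms(1,2) by (simp add: of_nat_diff)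
  moreover have "int (total_occ r s N l) = int lam * (int r + int s - int n) + int corner"
  proof -
    have "total_occ r s N l + n * lam = r * lam + s * lam + corner" using top right by linarith
    then have "int (total_occ r s N l + n * lam) = int (r * lam + s * lam + corner)" by (rule arg_cong)
    then show ?thesis by (simp add: algebra_simps)
  qed
  ultimately show "int lam * (int r + int s - int n) \<le> int (total_occ r s N l)"
    "int (total_occ r s N l) \<le> int lam * (int r + int s - int n) + (int n - int r) * (int n - int s)"
    by auto
qed

lemma simple_latin_cell_le:
  assumes "latin_rectangle lam n r s M" "simple_array r s M" "i \<in> {1..r}" "j \<in> {1..s}"
  shows "lam \<le> n"
proof -
  have "lam = (\<Sum>l\<in>{1..n}. count (M i j) l)"
    using assms by (auto simp: latin_rectangle_def sum_count_eq_size)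
  also have "\<dots> \<le> (\<Sum>l\<in>{1..n}. 1)"
    using assms by (intro sum_mono) (auto simp: simple_array_def)
  finally show ?thesis by simp
qed

theorem corollary4p2:
  fixes r s n lam :: nat and M :: mset_array
  assumes "n \<ge> 1" and "lam \<ge> 1" and "max r s \<le> n"
    and "latin_rectangle lam n r s M" and "simple_array r s M"
  shows "(\<exists>N. latin_square lam n N \<and> simple_array n n N \<and> top_left_subarray r s M N) \<longleftrightarrow>
    lam \<le> n \<and>
    (\<forall>l\<in>{1..n}. int lam * (int r + int s - int n) \<le> int (total_occ r s M l) \<and>
       int (total_occ r s M l) \<le>
         int lam * (int r + int s - int n) + (int n - int r) * (int n - int s)) \<and>
    (\<forall>i\<in>{1..r}. \<forall>l\<in>{1..n}. int (row_occ s M i l) \<ge> int lam + int s - int n) \<and>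
    (\<forall>j\<in>{1..s}. \<forall>l\<in>{1..n}. int (col_occ r M j l) \<ge> int lam + int r - int n)"
    (is "(\<exists>N. ?extends N) \<longleftrightarrow> ?conditions")
proof -
  have rs: "r \<le> n" "s \<le> n" using assms(3) by auto
  show ?thesis
  proof
    assume "\<exists>N. ?extends N"
    then obtain N where N: "latin_rectangle lam n n n N" "simple_array n n N"
      and "top_left_subarray r s M N" by (auto simp: latin_square_def)
    then have sub: "M i j = N i j" if "i \<in> {1..r}" "j \<in> {1..s}" for i j
      using that by (simp add: top_left_subarray_def)
    have occ: "total_occ r s M l = total_occ r s N l" for l
      by (simp add: total_occ_def sub)
    have row: "row_occ s M i l = row_occ s N i l" if "i \<in> {1..r}" for i l
      using that by (simp add: row_occ_def sub)
    have col: "col_occ r M j l = row_occ r (\<lambda>i j. N j i) j l" if "j \<in> {1..s}" for j l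
      using that by (simp add: col_occ_def row_occ_def sub)
    have "lam \<le> n"
      by (rule simple_latin_cell_le[OF N, of 1 1]) (use assms(1) in auto)
    moreover have "int (row_occ s N i l) \<ge> int lam + int s - int n"
      if "i \<in> {1..r}" "l \<in> {1..n}" for i l
      using row_occ_prefix_ge[OF rs(2) N, of i l] that rs by simp
    moreover have "int (row_occ r (\<lambda>i j. N j i) j l) \<ge> int lam + int r - int n"
      if "j \<in> {1..s}" "l \<in> {1..n}" for j l
      using row_occ_prefix_ge[OF rs(1) latin_rectangle_transpose[OF N(1)]
          simple_array_transpose[OF N(2)], of j l] that rs by simp
    ultimately show ?conditions
      using total_occ_corner_bounds[OF rs N] by (simp add: occ row col)
  next
    assume ?conditions
    then show "\<exists>N. ?extends N"
      by (intro extend_to_square[OF rs assms(4,5)]) auto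
  qed
qed

end
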